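(* Assume the P-Ideal Dichotomy (PID) and $\min\{\mathfrak b,\mathfrak s\} > \aleph_1$. Then every locally compact, $\omega_1$-compact space of weight $\aleph_1$ is $\sigma$-countably compact.
   Context: "Space" means Hausdorff topological space. A space is $\omega_1$-compact if each of its closed discrete subspaces is countable. A space is $\sigma$-countably compact if it is the union of countably many countably compact subspaces. The weight of a space is the least cardinality of a base for its topology. $\mathfrak b$ is the bounding number (the least cardinality of a $\le^*$-unbounded subset of $\omega^\omega$) and $\mathfrak s$ is the splitting number (the least cardinality of a family of subsets of $\omega$ such that for every infinite $A\subset\omega$ some member $B$ of the family has both $A\cap B$ and $A\setminus B$ infinite). A family $\mathcal I\subset\mathcal P(X)$ is an ideal on a set $X$ if it is closed under finite unions, contains all singletons, and is closed under taking subsets of its elements. An ideal $\mathcal I$ is a P-ideal if for every countable subfamily $\mathcal Q$ of $\mathcal I$ there exists $I\in\mathcal I$ such that $Q\setminus I$ is finite for every $Q\in\mathcal Q$. The PID states that, for every P-ideal $\mathcal I$ of subsets of a set $X$, either (A) there is an uncountable $A\subset X$ such that every countable subset of $A$ is in $\mathcal I$, or (B) $X$ is the union of countably many sets $\{B_n:n\in\omega\}$ such that $B_n\cap I$ is finite for all $n$ and all $I\in\mathcal I$. *)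

theory Defs
  imports "HOL-Analysis.Analysis"
begin

unbundle cardinal_syntax

definition aleph1 :: "nat set rel" where
  "aleph1 = cardSuc natLeq"

text \<open>The least cardinality of a set with property \<open>P\<close>, as the cardinal of some set attaining it.
  It is determined up to \<open>=o\<close>, and it is meaningful only if some set satisfies \<open>P\<close>;
  see the two lemmas below.\<close>

definition least_card :: "('a set \<Rightarrow> bool) \<Rightarrow> 'a rel" where
  "least_card P = |SOME A. P A \<and> (\<forall>B. P B \<longrightarrow> |A| \<le>o |B| )|"

lemma least_card_attained:
  assumes "P A"
  obtains B where "P B" "least_card P = |B|" "\<And>C. P C \<Longrightarrow> |B| \<le>o |C|"
proof -
  let ?R = "{ |B| | B. P B}"
  have "?R \<noteq> {}" and "\<forall>r\<in>?R. Well_order r"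
    using assms card_of_Well_order by auto
  then obtain r where "r \<in> ?R" and min: "\<forall>r'\<in>?R. r \<le>o r'"
    using exists_minim_Well_order[of ?R] by auto
  then obtain B0 where "P B0 \<and> (\<forall>C. P C \<longrightarrow> |B0| \<le>o |C| )" by blast
  then have "P (SOME A. P A \<and> (\<forall>B. P B \<longrightarrow> |A| \<le>o |B| ))
      \<and> (\<forall>C. P C \<longrightarrow> |SOME A. P A \<and> (\<forall>B. P B \<longrightarrow> |A| \<le>o |B| )| \<le>o |C| )"
    by (rule someI)
  then show ?thesis using that unfolding least_card_def by blast
qed

lemma least_card_le: "P A \<Longrightarrow> least_card P \<le>o |A|"
  by (metis least_card_attained)

definition le_star :: "(nat \<Rightarrow> nat) \<Rightarrow> (nat \<Rightarrow> nat) \<Rightarrow> bool" where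
  "le_star f g \<longleftrightarrow> finite {n. \<not> f n \<le> g n}"

definition unbounded_family :: "(nat \<Rightarrow> nat) set \<Rightarrow> bool" where
  "unbounded_family F \<longleftrightarrow> \<not> (\<exists>g. \<forall>f\<in>F. le_star f g)"

definition bounding_number :: "(nat \<Rightarrow> nat) rel" where
  "bounding_number = least_card unbounded_family"

definition splitting_family :: "nat set set \<Rightarrow> bool" where
  "splitting_family S \<longleftrightarrow>
     (\<forall>A. infinite A \<longrightarrow> (\<exists>B\<in>S. infinite (A \<inter> B) \<and> infinite (A - B)))"

definition splitting_number :: "nat set rel" where
  "splitting_number = least_card splitting_family"

definition base_for :: "'a topology \<Rightarrow> 'a set set \<Rightarrow> bool" where
  "base_for X \<B> \<longleftrightarrow>
     (\<forall>U\<in>\<B>. openin X U) \<and> (\<forall>U. openin X U \<longrightarrow> (\<exists>\<U>\<subseteq>\<B>. U = \<Union>\<U>))"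

definition weight :: "'a topology \<Rightarrow> 'a set rel" where
  "weight X = least_card (base_for X)"

definition omega1_compact_space :: "'a topology \<Rightarrow> bool" where
  "omega1_compact_space X \<longleftrightarrow>
     (\<forall>D. closedin X D \<and> subtopology X D = discrete_topology D \<longrightarrow> countable D)"

definition countably_compact_space :: "'a topology \<Rightarrow> bool" where
  "countably_compact_space X \<longleftrightarrow>
     (\<forall>\<U>. countable \<U> \<and> (\<forall>U\<in>\<U>. openin X U) \<and> \<Union>\<U> = topspace X \<longrightarrow>
        (\<exists>\<F>\<subseteq>\<U>. finite \<F> \<and> \<Union>\<F> = topspace X))"

definition sigma_countably_compact_space :: "'a topology \<Rightarrow> bool" where
  "sigma_countably_compact_space X \<longleftrightarrow>
     (\<exists>\<C>. countable \<C> \<and> (\<forall>C\<in>\<C>. countably_compact_space (subtopology X C)) \<and>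
        \<Union>\<C> = topspace X)"

definition ideal_on :: "'a set \<Rightarrow> 'a set set \<Rightarrow> bool" where
  "ideal_on X \<I> \<longleftrightarrow>
     \<I> \<subseteq> Pow X \<and>
     (\<forall>\<F>. finite \<F> \<and> \<F> \<subseteq> \<I> \<longrightarrow> \<Union>\<F> \<in> \<I>) \<and>
     (\<forall>x\<in>X. {x} \<in> \<I>) \<and>
     (\<forall>I\<in>\<I>. \<forall>J\<subseteq>I. J \<in> \<I>)"

definition P_ideal_on :: "'a set \<Rightarrow> 'a set set \<Rightarrow> bool" where
  "P_ideal_on X \<I> \<longleftrightarrow>
     ideal_on X \<I> \<and>
     (\<forall>\<Q>. countable \<Q> \<and> \<Q> \<subseteq> \<I> \<longrightarrow> (\<exists>I\<in>\<I>. \<forall>Q\<in>\<Q>. finite (Q - I)))"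

definition P_ideal_dichotomy_on :: "'a set \<Rightarrow> bool" where
  "P_ideal_dichotomy_on X \<longleftrightarrow>
     (\<forall>\<I>. P_ideal_on X \<I> \<longrightarrow>
        (\<exists>A\<subseteq>X. uncountable A \<and> (\<forall>C\<subseteq>A. countable C \<longrightarrow> C \<in> \<I>)) \<or>
        (\<exists>B :: nat \<Rightarrow> 'a set. X = (\<Union>n. B n) \<and> (\<forall>n. \<forall>I\<in>\<I>. finite (B n \<inter> I))))"

text \<open>HOL cannot quantify over all types inside a formula, so the dichotomy is stated for all sets
  whose elements are drawn from a given type.\<close>

definition PID :: "'a itself \<Rightarrow> bool" where
  "PID (_ :: 'a itself) \<longleftrightarrow> (\<forall>X :: 'a set. P_ideal_dichotomy_on X)"

end

theory Submission
  imports Defs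
begin

text \<open>
  The dichotomy is applied to the ideal of those countable subsets of \<open>X\<close> that meet every compact
  set in a finite set; in a locally compact Hausdorff space these are the countable closed discrete
  sets. It is a P-ideal because \<open>\<bb> > \<aleph>\<^sub>1\<close>: whether a countable set meets compact sets finitely
  can be tested on \<open>\<aleph>\<^sub>1\<close> many basic sets, those contained in a compact set, and a single
  function decides how many points to drop from each of countably many given members so that the
  union of what remains meets each of these basic sets in a finite set
  (\<open>P_ideal_compact_finite_sets\<close>).

  The first alternative of the dichotomy gives an uncountable set all of whose countable subsets
  meet compact sets finitely. Then so does the set itself, which makes it closed and discrete, and
  this is excluded by \<open>\<omega>\<^sub>1\<close>-compactness.

  The second alternative writes \<open>X\<close> as a union of countably many sets \<open>B n\<close> without infinite subset
  in the ideal. These are only relatively countably compact, and their closures are hard to control,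
  since a point of the closure need not be approached by a sequence. The set of limits of sequences
  from \<open>B n\<close> is good enough, however: it contains \<open>B n\<close> and it is countably compact
  (\<open>countably_compact_sequential_limits\<close>). The reason is a diagonal argument. Given points \<open>d i\<close>
  of that set, \<open>\<bb> > \<aleph>\<^sub>1\<close> yields points \<open>e i\<close> of \<open>B n\<close> that follow the \<open>d i\<close> so closely that
  subsequential limits of \<open>e\<close> are also subsequential limits of \<open>d\<close>. By the choice of \<open>B n\<close>,
  infinitely many \<open>e i\<close> lie in a single compact set. Since \<open>X\<close> has weight \<open>\<aleph>\<^sub>1\<close>,
  \<open>\<ss> > \<aleph>\<^sub>1\<close> makes compact sets sequentially compact: an infinite set of
  indices that none of the basic sets splits is a convergent subsequence
  (\<open>convergent_subsequence_in_compact\<close>).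
\<close>

section \<open>Small families and the two cardinal invariants\<close>

lemma small_family_dominated:
  fixes f :: "'i \<Rightarrow> nat \<Rightarrow> nat"
  assumes b: "aleph1 <o bounding_number" and J: "|J| \<le>o aleph1"
  obtains g where "\<And>j. j \<in> J \<Longrightarrow> finite {n. \<not> f j n \<le> g n}"
proof -
  have "\<not> unbounded_family (f ` J)"
  proof
    assume "unbounded_family (f ` J)"
    then have "bounding_number \<le>o |f ` J|"
      unfolding bounding_number_def by (rule least_card_le)
    also have "|f ` J| \<le>o |J|" by (rule card_of_image)
    also note J
    finally show False using b not_ordLess_ordLeq by blast
  qed
  then show ?thesis
    using that unfolding unbounded_family_def le_star_def by blast
qed

lemma small_family_unsplit:
  fixes S :: "'i \<Rightarrow> nat set"
  assumes s: "aleph1 <o splitting_number" and J: "|J| \<le>o aleph1"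
  obtains A where "infinite A" "\<And>j. j \<in> J \<Longrightarrow> finite (A \<inter> S j) \<or> finite (A - S j)"
proof -
  have "\<not> splitting_family (S ` J)"
  proof
    assume "splitting_family (S ` J)"
    then have "splitting_number \<le>o |S ` J|"
      unfolding splitting_number_def by (rule least_card_le)
    also have "|S ` J| \<le>o |J|" by (rule card_of_image)
    also note J
    finally show False using s not_ordLess_ordLeq by blast
  qed
  then show ?thesis
    using that unfolding splitting_family_def by blast
qed

section \<open>Bases and sequences\<close>

lemma base_for_openin: "base_for X \<B> \<Longrightarrow> W \<in> \<B> \<Longrightarrow> openin X W"
  by (simp add: base_for_def)

lemma base_for_neighbourhood:
  assumes "base_for X \<B>" "openin X U" "x \<in> U"
  obtains W where "W \<in> \<B>" "x \<in> W" "W \<subseteq> U"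
  using assms unfolding base_for_def by blast

lemma weight_attained:
  obtains \<B> where "base_for X \<B>" "weight X = |\<B>|"
proof -
  have "base_for X {U. openin X U}"
    unfolding base_for_def by (auto intro!: exI[of _ "{_}"])
  then show ?thesis
    using that unfolding weight_def by (metis least_card_attained)
qed

lemma countably_compact_space_if_convergent_subsequences:
  assumes "\<And>d. range d \<subseteq> topspace Y \<Longrightarrow>
    \<exists>r l. strict_mono (r :: nat \<Rightarrow> nat) \<and> limitin Y (d \<circ> r) l sequentially"
  shows "countably_compact_space Y"
  unfolding countably_compact_space_def
proof (intro allI impI, elim conjE)
  fix \<U> assume "countable \<U>" and op: "\<forall>U\<in>\<U>. openin Y U" and cov: "\<Union>\<U> = topspace Y"
  show "\<exists>\<F>\<subseteq>\<U>. finite \<F> \<and> \<Union>\<F> = topspace Y"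
  proof (rule ccontr)
    assume no: "\<not> ?thesis"
    then have "\<U> \<noteq> {}" using cov by blast
    then obtain u where u: "\<U> = range (u :: nat \<Rightarrow> _)"
      using range_from_nat_into[of \<U>] \<open>countable \<U>\<close> by metis
    have "\<exists>x \<in> topspace Y. x \<notin> \<Union>(u ` {..n})" for n
    proof -
      have "u ` {..n} \<subseteq> \<U>" "finite (u ` {..n})" by (auto simp: u)
      then have "\<Union>(u ` {..n}) \<noteq> topspace Y" using no by blast
      moreover have "\<Union>(u ` {..n}) \<subseteq> topspace Y" using cov u by blast
      ultimately show ?thesis by blast
    qed
    then obtain d where d: "\<And>n. d n \<in> topspace Y" "\<And>n. d n \<notin> \<Union>(u ` {..n})"
      by metis
    then obtain r l where r: "strict_mono (r :: nat \<Rightarrow> nat)"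
      and lim: "limitin Y (d \<circ> r) l sequentially"
      using assms[of d] by blast
    have "l \<in> topspace Y" using lim by (rule limitin_topspace)
    then obtain m where m: "l \<in> u m" using cov u by blast
    have "openin Y (u m)" using op u by blast
    then obtain N where N: "\<And>n. n \<ge> N \<Longrightarrow> d (r n) \<in> u m"
      using lim m unfolding limitin_sequentially by auto
    have "m \<le> r (max N m)"
      using seq_suble[OF r, of "max N m"] by simp
    then show False using N[of "max N m"] d(2)[of "r (max N m)"] by auto
  qed
qed

text \<open>An index set that no trace \<open>{n. e n \<in> W}\<close> of a basic set \<open>W\<close> splits is a subsequence that
  converges to each of its cluster points: a basic neighbourhood of a cluster point contains
  infinitely many of its terms, hence almost all of them.\<close>

lemma convergent_subsequence_in_compact:
  fixes e :: "nat \<Rightarrow> 'a"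
  assumes s: "aleph1 <o splitting_number" and base: "base_for X \<B>" and small: "|\<B>| \<le>o aleph1"
    and K: "compactin X K" and e: "range e \<subseteq> K"
  obtains r x where "strict_mono (r :: nat \<Rightarrow> nat)" "limitin X (e \<circ> r) x sequentially"
proof -
  obtain A where "infinite A"
    and A: "\<And>W. W \<in> \<B> \<Longrightarrow> finite (A \<inter> {n. e n \<in> W}) \<or> finite (A - {n. e n \<in> W})"
    using small_family_unsplit[OF s small, of "\<lambda>W. {n. e n \<in> W}"] by blast
  have "\<exists>x\<in>K. \<forall>W\<in>\<B>. x \<in> W \<longrightarrow> infinite (A \<inter> {n. e n \<in> W})"
  proof (rule ccontr)
    assume "\<not> ?thesis"
    then have "K \<subseteq> \<Union>{W \<in> \<B>. finite (A \<inter> {n. e n \<in> W})}" by auto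
    moreover have "\<forall>W \<in> {W \<in> \<B>. finite (A \<inter> {n. e n \<in> W})}. openin X W"
      using base base_for_openin by blast
    ultimately obtain \<F> where \<F>: "finite \<F>" "\<F> \<subseteq> {W \<in> \<B>. finite (A \<inter> {n. e n \<in> W})}" "K \<subseteq> \<Union>\<F>"
      using K unfolding compactin_def by meson
    then have "finite (\<Union>W\<in>\<F>. A \<inter> {n. e n \<in> W})" by (intro finite_UN_I) auto
    moreover have "A \<subseteq> (\<Union>W\<in>\<F>. A \<inter> {n. e n \<in> W})" using \<F>(3) e by blast
    ultimately show False using \<open>infinite A\<close> finite_subset by blast
  qed
  then obtain x where "x \<in> K" and x: "\<And>W. W \<in> \<B> \<Longrightarrow> x \<in> W \<Longrightarrow> infinite (A \<inter> {n. e n \<in> W})"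
    by blast
  define r where "r = enumerate A"
  have r: "strict_mono r" "\<And>n. r n \<in> A"
    using \<open>infinite A\<close> by (simp_all add: r_def strict_mono_enumerate enumerate_in_set)
  have "limitin X (e \<circ> r) x sequentially"
    unfolding limitin_def
  proof (intro conjI allI impI)
    show "x \<in> topspace X" using \<open>x \<in> K\<close> K compactin_subset_topspace by blast
    fix U assume "openin X U \<and> x \<in> U"
    then obtain W where W: "W \<in> \<B>" "x \<in> W" "W \<subseteq> U" using base base_for_neighbourhood by metis
    then have "finite (A - {n. e n \<in> W})" using A x by blast
    then have "finite (r -` (A - {n. e n \<in> W}))"
      using r(1) by (intro finite_vimageI strict_mono_imp_inj_on)
    moreover have "{n. e (r n) \<notin> U} \<subseteq> r -` (A - {n. e n \<in> W})"
      using r(2) W(3) by auto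
    ultimately have "finite {n. e (r n) \<notin> U}" using finite_subset by blast
    then show "\<forall>\<^sub>F n in sequentially. (e \<circ> r) n \<in> U"
      by (simp add: eventually_cofinite flip: cofinite_eq_sequentially)
  qed
  then show ?thesis using that r(1) by blast
qed

section \<open>The ideal of compact-finite countable sets\<close>

definition compact_finite_sets :: "'a topology \<Rightarrow> 'a set set" where
  "compact_finite_sets X =
     {I. I \<subseteq> topspace X \<and> countable I \<and> (\<forall>K. compactin X K \<longrightarrow> finite (I \<inter> K))}"

lemma ideal_compact_finite_sets: "ideal_on (topspace X) (compact_finite_sets X)"
  unfolding ideal_on_def
proof (intro conjI allI ballI impI)
  show "compact_finite_sets X \<subseteq> Pow (topspace X)"
    by (auto simp: compact_finite_sets_def)
next
  fix \<F> assume \<F>: "finite \<F> \<and> \<F> \<subseteq> compact_finite_sets X"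
  have "finite (\<Union>\<F> \<inter> K)" if "compactin X K" for K
  proof -
    have "finite (\<Union>I\<in>\<F>. I \<inter> K)"
      using \<F> that by (intro finite_UN_I) (auto simp: compact_finite_sets_def)
    then show ?thesis by simp
  qed
  moreover have "countable (\<Union>\<F>)"
    using \<F> countable_UN[of \<F> "\<lambda>I. I"] by (auto simp: compact_finite_sets_def countable_finite)
  ultimately show "\<Union>\<F> \<in> compact_finite_sets X"
    using \<F> by (auto simp: compact_finite_sets_def)
next
  fix x assume "x \<in> topspace X"
  then show "{x} \<in> compact_finite_sets X" by (simp add: compact_finite_sets_def)
next
  fix I J assume "I \<in> compact_finite_sets X" "J \<subseteq> I"
  then show "J \<in> compact_finite_sets X"
    unfolding compact_finite_sets_def
    by (auto intro: countable_subset finite_subset[of "J \<inter> _" "I \<inter> _"])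
qed

text \<open>Enumerate each member \<open>q k\<close> of the given countable subfamily. For a basic set \<open>W\<close> contained in
  a compact set, \<open>q k \<inter> W\<close> is finite, hence exhausted by an initial segment of the enumeration,
  whose length is a function of \<open>k\<close>. If \<open>g\<close> eventually dominates all these functions, the union over
  \<open>k\<close> of the sets \<open>q k\<close> without their first \<open>g k\<close> points meets \<open>W\<close> only through the finitely
  many \<open>k\<close> at which \<open>g\<close> fails to dominate.\<close>

lemma P_ideal_compact_finite_sets:
  assumes b: "aleph1 <o bounding_number" and base: "base_for X \<B>" and small: "|\<B>| \<le>o aleph1"
    and lc: "locally_compact_space X"
  shows "P_ideal_on (topspace X) (compact_finite_sets X)"
  unfolding P_ideal_on_def
proof (intro conjI allI impI, rule ideal_compact_finite_sets, elim conjE)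
  fix \<Q> assume "countable \<Q>" and sub: "\<Q> \<subseteq> compact_finite_sets X"
  show "\<exists>I\<in>compact_finite_sets X. \<forall>Q\<in>\<Q>. finite (Q - I)"
  proof (cases "\<Q> = {}")
    case True
    have "{} \<in> compact_finite_sets X" by (simp add: compact_finite_sets_def)
    with True show ?thesis by blast
  next
    case False
    then obtain q where q: "\<Q> = range (q :: nat \<Rightarrow> _)"
      using range_from_nat_into[of \<Q>] \<open>countable \<Q>\<close> by metis
    have mem: "q k \<in> compact_finite_sets X" for k using sub q by blast
    then have cnt: "countable (q k)" for k by (auto simp: compact_finite_sets_def)
    define \<W> where "\<W> = {W \<in> \<B>. \<exists>K. compactin X K \<and> W \<subseteq> K}"
    define num where "num k = to_nat_on (q k)" for k
    have "\<exists>m. \<forall>x \<in> q k \<inter> W. num k x < m" if "W \<in> \<W>" for W k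
    proof -
      obtain K where "compactin X K" "W \<subseteq> K" using \<open>W \<in> \<W>\<close> \<W>_def by blast
      then have "finite (q k \<inter> K)" using mem by (auto simp: compact_finite_sets_def)
      then have "finite (q k \<inter> W)"
        using \<open>W \<subseteq> K\<close> by (meson Int_mono finite_subset order_refl)
      then have "finite (num k ` (q k \<inter> W))" by simp
      then show ?thesis unfolding finite_nat_set_iff_bounded by blast
    qed
    then obtain f where f: "\<And>W k x. W \<in> \<W> \<Longrightarrow> x \<in> q k \<inter> W \<Longrightarrow> num k x < f W k"
      by metis
    have "|\<W>| \<le>o aleph1"
      using small card_of_mono1[of \<W> \<B>] ordLeq_transitive unfolding \<W>_def by blast
    then obtain g where g: "\<And>W. W \<in> \<W> \<Longrightarrow> finite {k. \<not> f W k \<le> g k}"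
      using small_family_dominated[OF b] by blast
    define I where "I = (\<Union>k. {x \<in> q k. g k \<le> num k x})"
    have IW: "finite (I \<inter> W)" if W: "W \<in> \<W>" for W
    proof -
      obtain K where K: "compactin X K" "W \<subseteq> K" using W \<W>_def by blast
      have "finite (q k \<inter> W)" for k
        using mem[of k] K unfolding compact_finite_sets_def
        by (intro finite_subset[of "q k \<inter> W" "q k \<inter> K"]) auto
      then have "finite (\<Union>k\<in>{k. \<not> f W k \<le> g k}. q k \<inter> W)" using g[OF W] by blast
      moreover have "I \<inter> W \<subseteq> (\<Union>k\<in>{k. \<not> f W k \<le> g k}. q k \<inter> W)"
      proof
        fix x assume "x \<in> I \<inter> W"
        then obtain k where k: "x \<in> q k \<inter> W" "g k \<le> num k x" unfolding I_def by blast
        then have "\<not> f W k \<le> g k" using f[OF W k(1)] by linarith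
        with k(1) show "x \<in> (\<Union>k\<in>{k. \<not> f W k \<le> g k}. q k \<inter> W)" by blast
      qed
      ultimately show ?thesis using finite_subset by blast
    qed
    have "finite (I \<inter> K)" if K: "compactin X K" for K
    proof -
      have "\<exists>W\<in>\<W>. x \<in> W" if "x \<in> K" for x
      proof -
        have "x \<in> topspace X" using K that compactin_subset_topspace by blast
        then obtain U C where U: "openin X U" "compactin X C" "x \<in> U" "U \<subseteq> C"
          using lc unfolding locally_compact_space_def by blast
        then obtain W where "W \<in> \<B>" "x \<in> W" "W \<subseteq> U" using base base_for_neighbourhood by metis
        then show ?thesis using U unfolding \<W>_def by blast
      qed
      then have "K \<subseteq> \<Union>\<W>" by blast
      moreover have "\<forall>W\<in>\<W>. openin X W" using base base_for_openin unfolding \<W>_def by blast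
      ultimately obtain \<F> where \<F>: "finite \<F>" "\<F> \<subseteq> \<W>" "K \<subseteq> \<Union>\<F>"
        using K unfolding compactin_def by meson
      then have "finite (\<Union>W\<in>\<F>. I \<inter> W)" using IW by blast
      then show ?thesis by (rule finite_subset[rotated]) (use \<F>(3) in blast)
    qed
    moreover have "I \<subseteq> topspace X" using mem unfolding I_def compact_finite_sets_def by auto
    moreover have "countable I"
      unfolding I_def by (intro countable_UN countable_Collect cnt) auto
    ultimately have "I \<in> compact_finite_sets X" by (simp add: compact_finite_sets_def)
    moreover have "finite (q k - I)" for k
    proof -
      have "inj_on (num k) (q k)" unfolding num_def using cnt by (rule inj_on_to_nat_on)
      then have "finite (num k -` {..<g k} \<inter> q k)" by (intro finite_vimage_IntI) auto
      moreover have "q k - I \<subseteq> num k -` {..<g k} \<inter> q k" unfolding I_def by auto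
      ultimately show ?thesis using finite_subset by blast
    qed
    ultimately show ?thesis using q by blast
  qed
qed

lemma compact_finite_imp_closed_discrete:
  assumes "Hausdorff_space X" and lc: "locally_compact_space X" and A: "A \<subseteq> topspace X"
    and fin: "\<And>K. compactin X K \<Longrightarrow> finite (A \<inter> K)"
  shows "closedin X A" "subtopology X A = discrete_topology A"
proof -
  have "x \<notin> X derived_set_of A" for x
  proof
    assume x: "x \<in> X derived_set_of A"
    then have "x \<in> topspace X" by (simp add: in_derived_set_of)
    then obtain U K where U: "openin X U" "compactin X K" "x \<in> U" "U \<subseteq> K"
      using lc unfolding locally_compact_space_def by blast
    have "t1_space X" using assms(1) by (rule Hausdorff_imp_t1_space)
    then have "infinite (A \<inter> U)"
      using x U by (auto simp: t1_space_derived_set_of_infinite_openin)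
    moreover have "finite (A \<inter> U)"
      using fin[OF U(2)] U(4) by (meson Int_mono finite_subset order_refl)
    ultimately show False by blast
  qed
  then have "X derived_set_of A = {}" by blast
  then show "closedin X A" "subtopology X A = discrete_topology A"
    using A by (simp_all add: closedin_contains_derived_set subtopology_eq_discrete_topology_eq)
qed

text \<open>An uncountable set as in the first alternative of the dichotomy would be closed and discrete:
  if it met a compact set in an infinite set, so would one of its countable subsets.\<close>

lemma omega1_compact_no_uncountable_compact_finite:
  assumes "Hausdorff_space X" "locally_compact_space X" "omega1_compact_space X"
    and A: "A \<subseteq> topspace X" and sub: "\<And>C. C \<subseteq> A \<Longrightarrow> countable C \<Longrightarrow> C \<in> compact_finite_sets X"
  shows "countable A"
proof -
  have "finite (A \<inter> K)" if K: "compactin X K" for K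
  proof (rule ccontr)
    assume "infinite (A \<inter> K)"
    then obtain C where C: "C \<subseteq> A \<inter> K" "infinite C" "countable C"
      using infinite_countable_subset' by metis
    then have "C \<in> compact_finite_sets X" using sub by blast
    then have "finite (C \<inter> K)" using K by (simp add: compact_finite_sets_def)
    moreover have "C \<inter> K = C" using C by blast
    ultimately show False using C by simp
  qed
  then show ?thesis
    using assms compact_finite_imp_closed_discrete[of X A] unfolding omega1_compact_space_def
    by blast
qed

section \<open>Limits of sequences from a set orthogonal to the ideal\<close>

definition sequential_limits :: "'a topology \<Rightarrow> 'a set \<Rightarrow> 'a set" where
  "sequential_limits X B = {x. \<exists>\<sigma>. range \<sigma> \<subseteq> B \<and> limitin X \<sigma> x sequentially}"

lemma sequential_limits_subset_topspace: "sequential_limits X B \<subseteq> topspace X"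
  by (auto simp: sequential_limits_def dest: limitin_topspace)

lemma subset_sequential_limits:
  assumes "B \<subseteq> topspace X"
  shows "B \<subseteq> sequential_limits X B"
proof
  fix x assume "x \<in> B"
  then have "range (\<lambda>n::nat. x) \<subseteq> B" "limitin X (\<lambda>n::nat. x) x sequentially"
    using assms by (auto simp: limitin_const)
  then show "x \<in> sequential_limits X B" unfolding sequential_limits_def by blast
qed

text \<open>Choose, for each \<open>n\<close>, a sequence in \<open>B\<close> converging to \<open>d n\<close>. If \<open>d n\<close> is outside the closure
  of a basic set \<open>W\<close>, the sequence leaves \<open>W\<close> for good from some stage on. A function that eventually
  dominates these \<open>\<aleph>\<^sub>1\<close> many stage functions picks the terms of the diagonal sequence.\<close>

lemma diagonal_sequence:
  assumes b: "aleph1 <o bounding_number" and base: "base_for X \<B>" and small: "|\<B>| \<le>o aleph1"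
    and d: "range d \<subseteq> sequential_limits X B"
  obtains e where "range e \<subseteq> B"
    "\<And>W. W \<in> \<B> \<Longrightarrow> finite {n :: nat. d n \<notin> X closure_of W \<and> e n \<in> W}"
proof -
  have "\<forall>n. \<exists>\<sigma>. range \<sigma> \<subseteq> B \<and> limitin X \<sigma> (d n) sequentially"
    using d unfolding sequential_limits_def by blast
  then obtain \<sigma> where \<sigma>: "\<And>n. range (\<sigma> n) \<subseteq> B" "\<And>n. limitin X (\<sigma> n) (d n) sequentially"
    by metis
  have "\<exists>m. d n \<notin> X closure_of W \<longrightarrow> (\<forall>k\<ge>m. \<sigma> n k \<notin> W)" if "W \<in> \<B>" for W n
  proof (cases "d n \<in> X closure_of W")
    case False
    have "W \<subseteq> X closure_of W"
      using base that by (intro closure_of_subset openin_subset base_for_openin)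
    have "d n \<in> topspace X - X closure_of W"
      using False \<sigma>(2) limitin_topspace by fastforce
    moreover have "openin X (topspace X - X closure_of W)" by (simp add: openin_diff)
    ultimately obtain N where "\<forall>k\<ge>N. \<sigma> n k \<in> topspace X - X closure_of W"
      using \<sigma>(2)[of n] unfolding limitin_sequentially by meson
    with \<open>W \<subseteq> X closure_of W\<close> have "\<forall>k\<ge>N. \<sigma> n k \<notin> W" by blast
    then show ?thesis by blast
  qed simp
  then obtain f where f: "\<And>W n k. W \<in> \<B> \<Longrightarrow> d n \<notin> X closure_of W \<Longrightarrow> f W n \<le> k \<Longrightarrow> \<sigma> n k \<notin> W"
    by metis
  obtain g where g: "\<And>W. W \<in> \<B> \<Longrightarrow> finite {n. \<not> f W n \<le> g n}"
    using small_family_dominated[OF b small] by blast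
  show ?thesis
  proof
    show "range (\<lambda>n. \<sigma> n (g n)) \<subseteq> B" using \<sigma>(1) by blast
    show "finite {n. d n \<notin> X closure_of W \<and> \<sigma> n (g n) \<in> W}" if "W \<in> \<B>" for W
      using f[OF that] by (intro finite_subset[OF _ g[OF that]]) blast
  qed
qed

text \<open>Regularity provides a basic neighbourhood \<open>W\<close> of \<open>x\<close> whose closure lies in the given
  neighbourhood. Almost all \<open>e (r n)\<close> are in \<open>W\<close>, and for only finitely many of these
  indices is \<open>d (r n)\<close> outside the closure of \<open>W\<close>.\<close>

lemma limitin_diagonal_sequence:
  assumes reg: "regular_space X" and base: "base_for X \<B>" and d: "range d \<subseteq> topspace X"
    and near: "\<And>W. W \<in> \<B> \<Longrightarrow> finite {n :: nat. d n \<notin> X closure_of W \<and> e n \<in> W}"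
    and r: "strict_mono r" and lim: "limitin X (e \<circ> r) x sequentially"
  shows "limitin X (d \<circ> r) x sequentially"
  unfolding limitin_def
proof (intro conjI allI impI)
  show "x \<in> topspace X" using lim by (rule limitin_topspace)
  fix U assume U: "openin X U \<and> x \<in> U"
  then have "closedin X (topspace X - U)" "x \<in> topspace X - (topspace X - U)"
    using \<open>x \<in> topspace X\<close> by auto
  then obtain V where V: "openin X V" "x \<in> V" "disjnt (topspace X - U) (X closure_of V)"
    using reg unfolding regular_space by blast
  obtain W where W: "W \<in> \<B>" "x \<in> W" "W \<subseteq> V" using base V base_for_neighbourhood by metis
  have cl: "X closure_of W \<subseteq> U"
    using V(3) closure_of_mono[OF W(3), of X] closure_of_subset_topspace[of X W]
    by (auto simp: disjnt_def)
  have "finite (r -` {n. d n \<notin> X closure_of W \<and> e n \<in> W})"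
    using r near[OF W(1)] by (intro finite_vimageI strict_mono_imp_inj_on)
  then have "\<forall>\<^sub>F n in sequentially. \<not> (d (r n) \<notin> X closure_of W \<and> e (r n) \<in> W)"
    by (simp add: eventually_cofinite vimage_def flip: cofinite_eq_sequentially)
  moreover have "\<forall>\<^sub>F n in sequentially. e (r n) \<in> W"
    using lim W(2) base_for_openin[OF base W(1)] by (simp add: limitin_def)
  ultimately show "\<forall>\<^sub>F n in sequentially. (d \<circ> r) n \<in> U"
    by eventually_elim (use cl in auto)
qed

text \<open>Passing to limits once is enough: a sequence \<open>d\<close> of limits inherits a subsequential limit
  from its diagonal sequence \<open>e\<close>, and as \<open>e\<close> runs in \<open>B\<close> this limit belongs to the set. If no
  compact set contained infinitely many terms of \<open>e\<close>, the range of \<open>e\<close> would be an infinite subset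
  of \<open>B\<close> in the ideal.\<close>

lemma countably_compact_sequential_limits:
  assumes b: "aleph1 <o bounding_number" and s: "aleph1 <o splitting_number"
    and base: "base_for X \<B>" and small: "|\<B>| \<le>o aleph1"
    and reg: "regular_space X" and B: "B \<subseteq> topspace X"
    and orth: "\<And>I. I \<in> compact_finite_sets X \<Longrightarrow> finite (B \<inter> I)"
  shows "countably_compact_space (subtopology X (sequential_limits X B))"
proof (rule countably_compact_space_if_convergent_subsequences)
  fix d :: "nat \<Rightarrow> 'a" assume "range d \<subseteq> topspace (subtopology X (sequential_limits X B))"
  then have d: "range d \<subseteq> sequential_limits X B" "range d \<subseteq> topspace X" by auto
  obtain e where e: "range e \<subseteq> B"
    and near: "\<And>W. W \<in> \<B> \<Longrightarrow> finite {n :: nat. d n \<notin> X closure_of W \<and> e n \<in> W}"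
    using diagonal_sequence[OF b base small d(1)] by blast
  have "\<exists>K. compactin X K \<and> infinite {n. e n \<in> K}"
  proof (rule ccontr)
    assume "\<not> ?thesis"
    then have fin: "finite {n. e n \<in> K}" if "compactin X K" for K using that by blast
    have "finite (range e \<inter> K)" if "compactin X K" for K
      by (rule finite_subset[OF _ finite_imageI[OF fin[OF that], of e]]) auto
    then have "range e \<in> compact_finite_sets X"
      using e B by (auto simp: compact_finite_sets_def)
    then have "finite (B \<inter> range e)" by (rule orth)
    then have "finite (range e)" using e by (simp add: Int_absorb1)
    \<comment> \<open>A finite range is itself a compact set that contains all terms of the sequence.\<close>
    then have "compactin X (range e)" using e B by (intro finite_imp_compactin) auto
    then show False using fin[of "range e"] by simp
  qed
  then obtain K where K: "compactin X K" "infinite {n. e n \<in> K}" by blast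
  define r where "r = enumerate {n. e n \<in> K}"
  have r: "strict_mono r" using K(2) by (simp add: r_def strict_mono_enumerate)
  have "range (e \<circ> r) \<subseteq> K" using enumerate_in_set[OF K(2)] by (auto simp: r_def)
  then obtain r' x where r': "strict_mono r'" and lim: "limitin X (e \<circ> r \<circ> r') x sequentially"
    using convergent_subsequence_in_compact[OF s base small K(1)] by blast
  have rr: "strict_mono (r \<circ> r')" using r r' by (rule strict_mono_o)
  have lim': "limitin X (e \<circ> (r \<circ> r')) x sequentially" using lim by (simp add: o_assoc)
  have "range (e \<circ> (r \<circ> r')) \<subseteq> B" using e by auto
  then have "x \<in> sequential_limits X B" using lim' unfolding sequential_limits_def by blast
  moreover have "limitin X (d \<circ> (r \<circ> r')) x sequentially"
    using limitin_diagonal_sequence[OF reg base d(2) near rr lim'] .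
  moreover have "d n \<in> sequential_limits X B" for n using d(1) by blast
  ultimately have
    "limitin (subtopology X (sequential_limits X B)) (d \<circ> (r \<circ> r')) x sequentially"
    by (simp add: limitin_subtopology)
  then show "\<exists>r l. strict_mono (r :: nat \<Rightarrow> nat) \<and>
      limitin (subtopology X (sequential_limits X B)) (d \<circ> r) l sequentially"
    using rr by blast
qed

section \<open>Sigma-countable compactness\<close>

theorem theorem2p7:
  fixes X :: "'a topology"
  assumes "PID TYPE('a)"
    and "aleph1 <o bounding_number" and "aleph1 <o splitting_number"
    and "Hausdorff_space X"
    and "locally_compact_space X"
    and "omega1_compact_space X"
    and "weight X =o aleph1"
  shows "sigma_countably_compact_space X"
proof -
  obtain \<B> where base: "base_for X \<B>" and "weight X = |\<B>|" by (rule weight_attained)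
  then have small: "|\<B>| \<le>o aleph1" using assms(7) ordIso_imp_ordLeq by metis
  have reg: "regular_space X"
    using assms(4,5) locally_compact_Hausdorff_imp_regular_space by blast
  have "P_ideal_on (topspace X) (compact_finite_sets X)"
    using P_ideal_compact_finite_sets assms(2,5) base small by blast
  moreover have "\<not> (\<exists>A\<subseteq>topspace X. uncountable A \<and>
      (\<forall>C\<subseteq>A. countable C \<longrightarrow> C \<in> compact_finite_sets X))"
    using omega1_compact_no_uncountable_compact_finite[OF assms(4-6)] by blast
  ultimately obtain B :: "nat \<Rightarrow> 'a set" where un: "topspace X = (\<Union>n. B n)"
    and orth: "\<And>n I. I \<in> compact_finite_sets X \<Longrightarrow> finite (B n \<inter> I)"
    using assms(1) unfolding PID_def P_ideal_dichotomy_on_def by meson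
  have B: "B n \<subseteq> topspace X" for n using un by blast
  have "\<Union>(range (\<lambda>n. sequential_limits X (B n))) = topspace X"
  proof
    show "\<Union>(range (\<lambda>n. sequential_limits X (B n))) \<subseteq> topspace X"
      by (intro UN_least sequential_limits_subset_topspace)
    show "topspace X \<subseteq> \<Union>(range (\<lambda>n. sequential_limits X (B n)))"
      unfolding un by (intro UN_mono subset_sequential_limits B order_refl)
  qed
  moreover have "countably_compact_space (subtopology X (sequential_limits X (B n)))" for n
    using countably_compact_sequential_limits[OF assms(2,3) base small reg B orth] .
  ultimately show ?thesis
    unfolding sigma_countably_compact_space_def
    by (intro exI[of _ "range (\<lambda>n. sequential_limits X (B n))"]) auto
qed

end
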